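(* Let $G_1$ and $G_2$ be two non-isomorphic graphs and $G=G_1+G_2$, and let $q$, $n_1,\ldots,n_t$, $m_1,\ldots,m_{t'}$ be as defined in the context. (i) If $q=0$, then $D(G_1+G_2)=\max\{D(G_1),D(G_2)\}$. (ii) If $q\neq 0$ and $z=\min\big\{\max\{n_1,\ldots,n_q\},\max\{m_1,\ldots,m_q\}\big\}$, then $D(G_1+G_2)\leq \max\{D(G_1),D(G_2)\}+z$.
   Context: All graphs are finite and simple. The join $G_1+G_2$ of graphs $G_1=(V_1,E_1)$, $G_2=(V_2,E_2)$ on disjoint vertex sets has vertex set $V_1\cup V_2$ and edge set $E_1\cup E_2\cup\{uv:u\in V_1,v\in V_2\}$. $D(\cdot)$ is the distinguishing number: the least $r$ such that there is a labeling $\phi:V\to\{1,\ldots,r\}$ preserved by no non-identity automorphism. $G[X]$ is the induced subgraph on $X$; $N_G(v)$ is the neighbourhood of $v$ and $\overline{N_G(v)}=V(G)\setminus N_G(v)$. Partition of $V_1$: choose $v_1\in V_1$, set $A:=\overline{N_G(v_1)}$; while some vertex $v$ of $G$ satisfies $\overline{N_G(v)}\cap A\neq\emptyset$ and $\overline{N_G(v)}\not\subseteq A$, replace $A$ by $A\cup\overline{N_G(v)}$; the final set is $A_1$. Then choose a vertex of $V_1$ outside $A_1$ and repeat to get $A_2$, etc., giving a partition $V_1=A_1\cup\cdots\cup A_k$. The same procedure in $V_2$ gives $V_2=B_1\cup\cdots\cup B_{k'}$. Let $H=\{G[A_1],\ldots,G[A_k]\}$ and $H'=\{G[B_1],\ldots,G[B_{k'}]\}$.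 Partition $H$ into isomorphism classes $\mathcal{A}_1,\ldots,\mathcal{A}_t$ (two members lie in the same class iff they are isomorphic), with $|\mathcal{A}_i|=n_i$, and partition $H'$ into isomorphism classes $\mathcal{B}_1,\ldots,\mathcal{B}_{t'}$ with $|\mathcal{B}_j|=m_j$. Let $q$ be the number of classes $\mathcal{A}_i$ whose members are isomorphic to the members of some class $\mathcal{B}_j$; the classes are indexed so that for $1\leq i\leq q$ the members of $\mathcal{A}_i$ are isomorphic to the members of $\mathcal{B}_i$, and for $i>q$ no member of $\mathcal{A}_i$ is isomorphic to a member of any $\mathcal{B}_j$. *)

theory Defs
  imports "Graph_Theory.Graph_Theory"
begin

text \<open>
  A finite simple graph is a \<^locale>\<open>pair_graph\<close>: every undirected edge \<open>uv\<close> is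
  represented by the two arcs \<open>(u, v)\<close> and \<open>(v, u)\<close>.  The null graph is allowed.
  Isomorphism is \<^const>\<open>digraph_iso\<close> and the induced subgraph is \<^const>\<open>induce_subgraph\<close>.
\<close>

definition join :: "'a pair_pre_digraph \<Rightarrow> 'a pair_pre_digraph \<Rightarrow> 'a pair_pre_digraph" where
  "join G1 G2 =
    \<lparr> pverts = pverts G1 \<union> pverts G2,
      parcs = parcs G1 \<union> parcs G2 \<union> pverts G1 \<times> pverts G2 \<union> pverts G2 \<times> pverts G1 \<rparr>"

definition automorphism :: "('a, 'b) pre_digraph \<Rightarrow> ('a \<Rightarrow> 'a) \<Rightarrow> bool" where
  "automorphism G f \<longleftrightarrow>
    (\<exists>hom. pre_digraph.digraph_isomorphism G hom \<and> app_iso hom G = G \<and> iso_verts hom = f)"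

text \<open>
  Only the values of an automorphism on the vertex set are meaningful, hence both
  the preservation of labels and being the identity are relativised to it.
\<close>

definition distinguishing_labeling :: "('a, 'b) pre_digraph \<Rightarrow> nat \<Rightarrow> ('a \<Rightarrow> nat) \<Rightarrow> bool" where
  "distinguishing_labeling G r \<phi> \<longleftrightarrow>
    \<phi> ` verts G \<subseteq> {1..r} \<and>
    \<not> (\<exists>f. automorphism G f \<and> (\<exists>v\<in>verts G. f v \<noteq> v) \<and> (\<forall>v\<in>verts G. \<phi> (f v) = \<phi> v))"

definition distinguishing_number :: "('a, 'b) pre_digraph \<Rightarrow> nat" where
  "distinguishing_number G = (LEAST r. \<exists>\<phi>. distinguishing_labeling G r \<phi>)"

definition neighbourhood :: "('a, 'b) pre_digraph \<Rightarrow> 'a \<Rightarrow> 'a set" where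
  "neighbourhood G v = {w \<in> verts G. v \<rightarrow>\<^bsub>G\<^esub> w}"

definition non_neighbourhood :: "('a, 'b) pre_digraph \<Rightarrow> 'a \<Rightarrow> 'a set" where
  "non_neighbourhood G v = verts G - neighbourhood G v"

text \<open>
  The partition procedure makes arbitrary choices, so it is described by relations:
  \<open>enlarge\<close> is one pass through the body of the while loop, \<open>block_from G v A\<close> says that
  the loop started from the non-neighbourhood of \<open>v\<close> may terminate with \<open>A\<close>, and
  \<open>partial_run G W As\<close> says that \<open>As\<close> may be the list of blocks found so far in \<open>W\<close>.
\<close>

inductive enlarge :: "('a, 'b) pre_digraph \<Rightarrow> 'a set \<Rightarrow> 'a set \<Rightarrow> bool"
  for G :: "('a, 'b) pre_digraph" where
  "\<lbrakk> v \<in> verts G; non_neighbourhood G v \<inter> A \<noteq> {}; \<not> non_neighbourhood G v \<subseteq> A \<rbrakk>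
    \<Longrightarrow> enlarge G A (A \<union> non_neighbourhood G v)"

definition block_from :: "('a, 'b) pre_digraph \<Rightarrow> 'a \<Rightarrow> 'a set \<Rightarrow> bool" where
  "block_from G v A \<longleftrightarrow>
    (enlarge G)\<^sup>*\<^sup>* (non_neighbourhood G v) A \<and> \<not> (\<exists>A'. enlarge G A A')"

inductive partial_run :: "('a, 'b) pre_digraph \<Rightarrow> 'a set \<Rightarrow> 'a set list \<Rightarrow> bool"
  for G :: "('a, 'b) pre_digraph" and W :: "'a set" where
  start: "partial_run G W []"
| next_block: "\<lbrakk> partial_run G W As; v \<in> W; v \<notin> \<Union> (set As); block_from G v A \<rbrakk>
    \<Longrightarrow> partial_run G W (As @ [A])"

definition procedure_output :: "('a, 'b) pre_digraph \<Rightarrow> 'a set \<Rightarrow> 'a set list \<Rightarrow> bool" where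
  "procedure_output G W As \<longleftrightarrow> partial_run G W As \<and> W \<subseteq> \<Union> (set As)"

definition induced_subgraphs ::
    "('a, 'b) pre_digraph \<Rightarrow> 'a set list \<Rightarrow> ('a, 'b) pre_digraph set" where
  "induced_subgraphs G As = (\<lambda>A. G \<restriction> A) ` set As"

definition iso_classes :: "('a, 'b) pre_digraph set \<Rightarrow> ('a, 'b) pre_digraph set set" where
  "iso_classes H = H // {(X, Y). X \<in> H \<and> Y \<in> H \<and> digraph_iso X Y}"

end

theory Submission
  imports Defs
begin

text \<open>
  Automorphisms of the join permute the blocks, and map a block to an isomorphic one.  Given optimal
  labelings of the two sides, mark one vertex in each block of the first side that has an isomorphic
  block on the other side, and give the marked vertices fresh labels, different ones in isomorphic
  blocks.  A label-preserving automorphism then cannot move a block to the other side, hence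
  preserves both sides.  It fixes the marked vertices, so it also preserves the labels erased there,
  and is therefore the identity on each side.  If no block has an isomorphic partner, no fresh label
  is needed; by symmetry either side may be the marked one.
\<close>

section \<open>Automorphisms and isomorphisms in terms of vertex maps\<close>

text \<open>Arcs are pairs with \<open>fst\<close> as tail and \<open>snd\<close> as head, so the
  arc part of an automorphism is forced to act as \<open>map_prod f f\<close>. What remains is a
  vertex bijection that preserves and reflects adjacency.\<close>

lemma automorphism_with_proj_iff:
  assumes "pair_wf_digraph K"
  shows "automorphism (with_proj K) f \<longleftrightarrow>
    bij_betw f (pverts K) (pverts K) \<and>
    (\<forall>u\<in>pverts K. \<forall>v\<in>pverts K. (f u, f v) \<in> parcs K \<longleftrightarrow> (u, v) \<in> parcs K)"
    (is "?L \<longleftrightarrow> ?R")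
proof
  interpret pair_wf_digraph K by fact
  assume ?L
  then obtain hom where hom: "digraph_isomorphism hom"
    and app: "app_iso hom (with_proj K) = with_proj K" and f: "iso_verts hom = f"
    unfolding automorphism_def by blast
  have inj: "inj_on f (pverts K)"
    using hom f unfolding digraph_isomorphism_def by simp
  have im: "f ` pverts K = pverts K"
    using arg_cong[OF app, of verts] f by simp
  have arcs: "iso_arcs hom ` parcs K = parcs K"
    using arg_cong[OF app, of arcs] by simp
  have tl: "iso_tail hom = fst" and hd: "iso_head hom = snd"
    using arg_cong[OF app, of tail] arg_cong[OF app, of head] by simp_all
  have img: "iso_arcs hom a = (f (fst a), f (snd a))" if "a \<in> parcs K" for a
    using hom that f tl hd unfolding digraph_isomorphism_def by (simp add: prod_eq_iff)
  have "(f u, f v) \<in> parcs K \<longleftrightarrow> (u, v) \<in> parcs K"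
    if "u \<in> pverts K" "v \<in> pverts K" for u v
  proof
    assume "(f u, f v) \<in> parcs K"
    then obtain a where a: "a \<in> parcs K" "iso_arcs hom a = (f u, f v)"
      using arcs by (metis imageE)
    then have "fst a = u" "snd a = v"
      using img[OF a(1)] inj that arc_fst_in_verts arc_snd_in_verts by (auto dest: inj_onD)
    then show "(u, v) \<in> parcs K" using a(1) by force
  next
    assume "(u, v) \<in> parcs K"
    then show "(f u, f v) \<in> parcs K" using img arcs by force
  qed
  then show ?R using inj im by (simp add: bij_betw_def)
next
  interpret pair_wf_digraph K by fact
  assume R: ?R
  let ?hom = "\<lparr>iso_verts = f, iso_arcs = map_prod f f, iso_head = snd, iso_tail = fst\<rparr>"
  have inj: "inj_on f (pverts K)" and im: "f ` pverts K = pverts K"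
    using R by (auto simp: bij_betw_def)
  have "inj_on (map_prod f f) (parcs K)"
    by (rule inj_on_subset[OF map_prod_inj_on[OF inj inj]]) (auto dest: wellformed')
  moreover have "map_prod f f ` parcs K = parcs K"
  proof
    show "map_prod f f ` parcs K \<subseteq> parcs K" using R wellformed' by auto
    show "parcs K \<subseteq> map_prod f f ` parcs K"
    proof (rule subrelI)
      fix x y assume xy: "(x, y) \<in> parcs K"
      then obtain u v where "u \<in> pverts K" "v \<in> pverts K" "x = f u" "y = f v"
        using im wellformed' by (metis imageE)
      then show "(x, y) \<in> map_prod f f ` parcs K" using R xy by force
    qed
  qed
  ultimately have "digraph_isomorphism ?hom" "app_iso ?hom (with_proj K) = with_proj K"
    using inj im wf_digraph by (simp_all add: pre_digraph.digraph_isomorphism_def app_iso_def with_proj_def)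
  then show ?L unfolding automorphism_def by fastforce
qed

lemma automorphism_with_projD:
  assumes "pair_wf_digraph K" "automorphism (with_proj K) f"
  shows "inj_on f (pverts K)" "f ` pverts K = pverts K"
    "\<And>u v. u \<in> pverts K \<Longrightarrow> v \<in> pverts K \<Longrightarrow> (f u, f v) \<in> parcs K \<longleftrightarrow> (u, v) \<in> parcs K"
  using assms(2) unfolding automorphism_with_proj_iff[OF assms(1)] bij_betw_def by blast+

text \<open>The automorphism itself, restricted to \<open>A\<close>, is the isomorphism. Since it
  also reflects arcs, every arc inside the image comes from an arc inside \<open>A\<close>.\<close>

lemma automorphism_induce_subgraph_iso:
  assumes "pair_wf_digraph K" "automorphism (with_proj K) f" "A \<subseteq> pverts K"
  shows "digraph_iso (with_proj K \<restriction> A) (with_proj K \<restriction> (f ` A))"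
proof -
  interpret pair_wf_digraph K by fact
  let ?hom = "\<lparr>iso_verts = f, iso_arcs = map_prod f f, iso_head = snd, iso_tail = fst\<rparr>"
  note f = automorphism_with_projD[OF assms(1,2)]
  have inj: "inj_on f A" by (rule inj_on_subset[OF f(1) assms(3)])
  have "inj_on (map_prod f f) {e \<in> parcs K. fst e \<in> A \<and> snd e \<in> A}"
    by (rule inj_on_subset[OF map_prod_inj_on[OF inj inj]]) auto
  then have "pre_digraph.digraph_isomorphism (with_proj K \<restriction> A) ?hom"
    using inj wellformed_induce_subgraph[of A]
    by (simp add: pre_digraph.digraph_isomorphism_def)
  moreover have "map_prod f f ` {e \<in> parcs K. fst e \<in> A \<and> snd e \<in> A}
      = {e \<in> parcs K. fst e \<in> f ` A \<and> snd e \<in> f ` A}"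
    using f(3) assms(3) by (force simp: image_iff)
  then have "with_proj K \<restriction> (f ` A) = app_iso ?hom (with_proj K \<restriction> A)"
    by (simp add: app_iso_def induce_subgraph_def)
  ultimately show ?thesis unfolding digraph_iso_def by blast
qed

lemma digraph_iso_refl:
  assumes "wf_digraph K"
  shows "digraph_iso K K"
proof -
  interpret wf_digraph K by fact
  let ?hom = "\<lparr>iso_verts = id, iso_arcs = id, iso_head = head K, iso_tail = tail K\<rparr>"
  have "digraph_isomorphism ?hom" "K = app_iso ?hom K"
    using wf_digraph by (simp_all add: digraph_isomorphism_def app_iso_def)
  then show ?thesis unfolding digraph_iso_def by blast
qed

section \<open>Existence of optimal distinguishing labelings\<close>

lemma distinguishing_labeling_mono:
  "distinguishing_labeling K r \<phi> \<Longrightarrow> r \<le> s \<Longrightarrow> distinguishing_labeling K s \<phi>"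
  unfolding distinguishing_labeling_def by fastforce

text \<open>An injective labeling is preserved by the identity only. The enumeration starts at 0,
  hence the shift by \<open>Suc\<close> into \<open>{1..k}\<close>. This guarantees that the minimum
  in \<open>distinguishing_number\<close> is attained.\<close>

lemma ex_distinguishing_labeling:
  assumes "finite (verts K)"
  shows "\<exists>r \<phi>. distinguishing_labeling K r \<phi>"
proof -
  obtain \<psi> :: "_ \<Rightarrow> nat" and k where \<psi>: "\<psi> ` verts K = {i. i < k}" "inj_on \<psi> (verts K)"
    using finite_imp_inj_to_nat_seg[OF assms] by blast
  have "f v = v" if "automorphism K f" "v \<in> verts K" "Suc (\<psi> (f v)) = Suc (\<psi> v)" for f v
  proof -
    have "f ` verts K = verts K"
      using that(1) unfolding automorphism_def by (metis verts_app_iso)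
    then show ?thesis using that \<psi>(2) by (auto dest: inj_onD)
  qed
  then have "distinguishing_labeling K k (\<lambda>v. Suc (\<psi> v))"
    using \<psi>(1) unfolding distinguishing_labeling_def by (auto simp: set_eq_iff image_iff Suc_le_eq)
  then show ?thesis by blast
qed

lemma ex_optimal_labeling:
  assumes "finite (verts K)"
  shows "\<exists>\<phi>. distinguishing_labeling K (distinguishing_number K) \<phi>"
  unfolding distinguishing_number_def
  using ex_distinguishing_labeling[OF assms] by (rule LeastI_ex)

lemma distinguishing_number_le:
  "distinguishing_labeling K r \<phi> \<Longrightarrow> distinguishing_number K \<le> r"
  unfolding distinguishing_number_def by (blast intro: Least_le)

section \<open>Blocks as components of the complement graph\<close>

text \<open>In a simple graph these sets are the unions of components of the complement. The formula
  is chosen to say that no \<open>enlarge\<close> step leads out of \<open>S\<close>.\<close>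

definition nonadjacency_closed :: "('a, 'b) pre_digraph \<Rightarrow> 'a set \<Rightarrow> bool" where
  "nonadjacency_closed K S \<longleftrightarrow>
    S \<subseteq> verts K \<and> (\<forall>v\<in>verts K. non_neighbourhood K v \<inter> S \<noteq> {} \<longrightarrow> non_neighbourhood K v \<subseteq> S)"

text \<open>The blocks of the partition procedure are the vertex sets of the components of the complement.\<close>

definition block :: "('a, 'b) pre_digraph \<Rightarrow> 'a set \<Rightarrow> bool" where
  "block K A \<longleftrightarrow> A \<noteq> {} \<and> nonadjacency_closed K A \<and>
    (\<forall>S. nonadjacency_closed K S \<and> S \<inter> A \<noteq> {} \<longrightarrow> A \<subseteq> S)"

lemma block_eqI: "block K A \<Longrightarrow> block K B \<Longrightarrow> x \<in> A \<Longrightarrow> x \<in> B \<Longrightarrow> A = B"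
  unfolding block_def by blast

lemma self_in_non_neighbourhood:
  "loopfree_digraph K \<Longrightarrow> v \<in> verts K \<Longrightarrow> v \<in> non_neighbourhood K v"
  unfolding non_neighbourhood_def neighbourhood_def
  using loopfree_digraph.adj_not_same by fastforce

text \<open>A non-neighbourhood that meets the complement of \<open>S\<close> is not contained in
  \<open>S\<close>, hence misses \<open>S\<close>.\<close>

lemma nonadjacency_closed_Diff:
  "nonadjacency_closed K S \<Longrightarrow> nonadjacency_closed K (verts K - S)"
  unfolding nonadjacency_closed_def non_neighbourhood_def by blast

text \<open>Each step adds a non-neighbourhood that meets the current set. While that set lies in
  \<open>S\<close>, the added part meets \<open>S\<close> and so lies in \<open>S\<close>
  too.\<close>

lemma enlarge_subset_closed:
  assumes "(enlarge K)\<^sup>*\<^sup>* A B" "nonadjacency_closed K S" "A \<subseteq> S"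
  shows "B \<subseteq> S"
  using assms(1)
proof induction
  case base
  show ?case by fact
next
  case (step B C)
  from step(2) show ?case
    using step.IH assms(2) unfolding nonadjacency_closed_def by cases blast
qed

lemma enlarge_supset: "(enlarge K)\<^sup>*\<^sup>* A B \<Longrightarrow> A \<subseteq> B"
  by (induction rule: rtranclp_induct) (auto elim!: enlarge.cases)

text \<open>The loop stops at a closed set, and this set lies in every closed set containing
  \<open>v\<close>. A closed set that misses \<open>v\<close> has a closed complement containing
  \<open>v\<close>, hence containing \<open>A\<close>, so it cannot meet \<open>A\<close>. The
  result is therefore independent of the choices made in the loop.\<close>

lemma block_from_imp_block:
  assumes "loopfree_digraph K" "v \<in> verts K" "block_from K v A"
  shows "block K A \<and> v \<in> A"
proof -
  have run: "(enlarge K)\<^sup>*\<^sup>* (non_neighbourhood K v) A" and stop: "\<not> (\<exists>A'. enlarge K A A')"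
    using assms(3) unfolding block_from_def by auto
  have v: "v \<in> non_neighbourhood K v" by (rule self_in_non_neighbourhood[OF assms(1,2)])
  have vA: "v \<in> A" using enlarge_supset[OF run] v by blast
  have least: "A \<subseteq> S" if "nonadjacency_closed K S" "v \<in> S" for S
  proof (rule enlarge_subset_closed[OF run that(1)])
    show "non_neighbourhood K v \<subseteq> S"
      using that v assms(2) unfolding nonadjacency_closed_def by blast
  qed
  have "nonadjacency_closed K (verts K)"
    unfolding nonadjacency_closed_def non_neighbourhood_def by blast
  then have "A \<subseteq> verts K" using least assms(2) by blast
  then have "nonadjacency_closed K A"
    using stop unfolding nonadjacency_closed_def by (blast intro: enlarge.intros)
  moreover have "A \<subseteq> S" if S: "nonadjacency_closed K S" "S \<inter> A \<noteq> {}" for S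
  proof (cases "v \<in> S")
    case False
    then have "A \<subseteq> verts K - S" using least nonadjacency_closed_Diff[OF S(1)] assms(2) by blast
    then show ?thesis using S(2) by blast
  qed (use least S in blast)
  ultimately show ?thesis using vA unfolding block_def by blast
qed

lemma procedure_output_blocks:
  assumes "loopfree_digraph K" "nonadjacency_closed K W" "procedure_output K W As"
  shows "\<forall>A\<in>set As. block K A \<and> A \<subseteq> W" "\<Union> (set As) = W"
proof -
  have "partial_run K W As" and cover: "W \<subseteq> \<Union> (set As)"
    using assms(3) unfolding procedure_output_def by auto
  from this(1) show *: "\<forall>A\<in>set As. block K A \<and> A \<subseteq> W"
  proof induction
    case (next_block As v A)
    have "v \<in> verts K" using next_block(2) assms(2) unfolding nonadjacency_closed_def by blast
    then have "block K A" "v \<in> A"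
      using block_from_imp_block[OF assms(1) _ next_block(4)] by auto
    \<comment> \<open>\<open>W\<close> is closed and meets \<open>A\<close> in \<open>v\<close>, so
      minimality of the block confines \<open>A\<close> to \<open>W\<close>.\<close>
    then have "A \<subseteq> W" using next_block(2) assms(2) unfolding block_def by blast
    then show ?case using next_block.IH \<open>block K A\<close> by auto
  qed simp
  show "\<Union> (set As) = W" using * cover by blast
qed

section \<open>Automorphisms permute the blocks\<close>

lemma automorphism_image_non_neighbourhood:
  assumes "pair_wf_digraph K" "automorphism (with_proj K) f" "v \<in> pverts K"
  shows "f ` non_neighbourhood (with_proj K) v = non_neighbourhood (with_proj K) (f v)"
proof -
  note im = automorphism_with_projD(2)[OF assms(1,2)]
    and arc = automorphism_with_projD(3)[OF assms(1,2)]
  show ?thesis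
  proof (intro subset_antisym subsetI)
    fix x assume "x \<in> f ` non_neighbourhood (with_proj K) v"
    then show "x \<in> non_neighbourhood (with_proj K) (f v)"
      using im arc assms(3) by (auto simp: non_neighbourhood_def neighbourhood_def)
  next
    fix x assume x: "x \<in> non_neighbourhood (with_proj K) (f v)"
    then obtain w where w: "x = f w" "w \<in> pverts K"
      using im by (auto simp: non_neighbourhood_def)
    then have "(v, w) \<notin> parcs K"
      using x arc[OF assms(3) w(2)] im by (auto simp: non_neighbourhood_def neighbourhood_def)
    then show "x \<in> f ` non_neighbourhood (with_proj K) v"
      using w by (auto simp: non_neighbourhood_def neighbourhood_def)
  qed
qed

lemma automorphism_nonadjacency_closed_image_iff:
  assumes "pair_wf_digraph K" "automorphism (with_proj K) f" "S \<subseteq> pverts K"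
  shows "nonadjacency_closed (with_proj K) (f ` S) \<longleftrightarrow> nonadjacency_closed (with_proj K) S"
proof -
  let ?N = "non_neighbourhood (with_proj K)"
  note inj = automorphism_with_projD(1)[OF assms(1,2)]
    and im = automorphism_with_projD(2)[OF assms(1,2)]
  have N: "?N v \<subseteq> pverts K" for v by (auto simp: non_neighbourhood_def)
  have "?N (f v) \<inter> f ` S = f ` (?N v \<inter> S)" if "v \<in> pverts K" for v
    using automorphism_image_non_neighbourhood[OF assms(1,2) that]
      inj_on_image_Int[OF inj N assms(3)] by simp
  moreover have "?N (f v) \<subseteq> f ` S \<longleftrightarrow> ?N v \<subseteq> S" if "v \<in> pverts K" for v
    using automorphism_image_non_neighbourhood[OF assms(1,2) that]
      inj_on_image_mem_iff[OF inj _ assms(3)] N[of v] by blast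
  \<comment> \<open>Every vertex has the form \<open>f v\<close>, so the quantifier over vertices
    can be reindexed along \<open>f\<close>.\<close>
  moreover have "(\<forall>v\<in>pverts K. ?N v \<inter> f ` S \<noteq> {} \<longrightarrow> ?N v \<subseteq> f ` S) \<longleftrightarrow>
      (\<forall>v\<in>pverts K. ?N (f v) \<inter> f ` S \<noteq> {} \<longrightarrow> ?N (f v) \<subseteq> f ` S)"
    by (rule trans[OF ball_cong[OF im[symmetric] refl]]) simp
  moreover have "f ` S \<subseteq> pverts K" using assms(3) im by blast
  ultimately show ?thesis using assms(3) unfolding nonadjacency_closed_def by simp
qed

lemma automorphism_block_image:
  assumes "pair_wf_digraph K" "automorphism (with_proj K) f" "block (with_proj K) A"
  shows "block (with_proj K) (f ` A)"
proof -
  note inj = automorphism_with_projD(1)[OF assms(1,2)]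
    and im = automorphism_with_projD(2)[OF assms(1,2)]
  have A: "A \<noteq> {}" "nonadjacency_closed (with_proj K) A" "A \<subseteq> pverts K"
    using assms(3) by (auto simp: block_def nonadjacency_closed_def)
  have "f ` A \<subseteq> S" if S: "nonadjacency_closed (with_proj K) S" "S \<inter> f ` A \<noteq> {}" for S
  proof -
    have "S \<subseteq> pverts K" using S(1) by (simp add: nonadjacency_closed_def)
    \<comment> \<open>Minimality of the image is obtained by pulling a closed set back along
      \<open>f\<close>, where minimality of \<open>A\<close> applies.\<close>
    then obtain T where T: "T \<subseteq> pverts K" "S = f ` T" using im by (metis subset_imageE)
    then have "nonadjacency_closed (with_proj K) T"
      using automorphism_nonadjacency_closed_image_iff[OF assms(1,2)] S(1) by blast
    moreover have "T \<inter> A \<noteq> {}"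
      using S(2) T inj_on_image_Int[OF inj T(1) A(3)] by auto
    ultimately show ?thesis using assms(3) T(2) unfolding block_def by blast
  qed
  then show ?thesis
    using A automorphism_nonadjacency_closed_image_iff[OF assms(1,2) A(3)] unfolding block_def by blast
qed

section \<open>The join and its two sides\<close>

lemma join_commute: "join K L = join L K"
  by (auto simp: join_def)

lemma join_simps [simp]:
  "pverts (join K L) = pverts K \<union> pverts L"
  "parcs (join K L) = parcs K \<union> parcs L \<union> pverts K \<times> pverts L \<union> pverts L \<times> pverts K"
  by (simp_all add: join_def)

locale disjoint_join =
  fixes K L :: "'a pair_pre_digraph"
  assumes K: "pair_graph K" and L: "pair_graph L"
    and disjoint: "pverts K \<inter> pverts L = {}"
begin

sublocale K: pair_graph K by (rule K)
sublocale L: pair_graph L by (rule L)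

text \<open>Together with \<open>join_commute\<close> this turns every fact about the left side into
  one about the right side.\<close>

lemma swap: "disjoint_join L K"
  using K L disjoint by unfold_locales auto

lemma arc_join_left_iff:
  "u \<in> pverts K \<Longrightarrow> v \<in> pverts K \<Longrightarrow> (u, v) \<in> parcs (join K L) \<longleftrightarrow> (u, v) \<in> parcs K"
  using disjoint L.wellformed' by auto

lemma wf_join: "pair_wf_digraph (join K L)"
  using K.wellformed' L.wellformed' by unfold_locales fastforce+

lemma loopfree_join: "loopfree_digraph (with_proj (join K L))"
proof -
  interpret pair_wf_digraph "join K L" by (rule wf_join)
  show ?thesis
    using K.pair_no_loops L.pair_no_loops disjoint by unfold_locales auto
qed

lemma finite_join: "finite (verts (with_proj (join K L)))"
  using K.pair_finite_verts L.pair_finite_verts by simp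

text \<open>A vertex is adjacent to everything on the opposite side, so its non-neighbourhood stays
  on its own side. Hence no block straddles the two sides.\<close>

lemma closed_left: "nonadjacency_closed (with_proj (join K L)) (pverts K)"
  unfolding nonadjacency_closed_def non_neighbourhood_def neighbourhood_def by auto

text \<open>A distinguishing labeling of the join restricts to one of \<open>K\<close>, because
  automorphisms of \<open>K\<close> extend to the join.\<close>

lemma distinguishing_number_left_le:
  "distinguishing_number (with_proj K) \<le> distinguishing_number (with_proj (join K L))"
proof -
  obtain \<phi> where \<phi>: "distinguishing_labeling (with_proj (join K L))
      (distinguishing_number (with_proj (join K L))) \<phi>"
    using ex_optimal_labeling[OF finite_join] by blast
  have "f v = v" if f: "automorphism (with_proj K) f"
    and lab: "\<forall>v\<in>pverts K. \<phi> (f v) = \<phi> v" and v: "v \<in> pverts K" for f v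
  proof -
    \<comment> \<open>The extension is the identity on \<open>L\<close>; adjacency across the sides
      is complete, so it is preserved automatically.\<close>
    define g where "g = (\<lambda>x. if x \<in> pverts K then f x else x)"
    have bij: "bij_betw f (pverts K) (pverts K)"
      and arc: "\<And>u v. u \<in> pverts K \<Longrightarrow> v \<in> pverts K \<Longrightarrow> (f u, f v) \<in> parcs K \<longleftrightarrow> (u, v) \<in> parcs K"
      using f automorphism_with_proj_iff[OF K.pair_wf_digraph] by auto
    have fK: "f x \<in> pverts K" if "x \<in> pverts K" for x using bij that by (auto simp: bij_betw_def)
    have "bij_betw g (pverts K) (pverts K)"
      using bij by (rule bij_betw_cong[THEN iffD1, rotated]) (simp add: g_def)
    moreover have "bij_betw g (pverts L) (pverts L)"
      using disjoint by (intro bij_betwI'[of "pverts L"]) (auto simp: g_def)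
    ultimately have "bij_betw g (pverts K \<union> pverts L) (pverts K \<union> pverts L)"
      using disjoint by (intro bij_betw_combine)
    moreover have "(g u, g v) \<in> parcs (join K L) \<longleftrightarrow> (u, v) \<in> parcs (join K L)"
      if "u \<in> pverts (join K L)" "v \<in> pverts (join K L)" for u v
      using that arc[of u v] fK[of u] fK[of v] disjoint K.wellformed' L.wellformed'
      unfolding g_def by auto
    ultimately have "automorphism (with_proj (join K L)) g"
      using automorphism_with_proj_iff[OF wf_join] by simp
    moreover have "\<forall>v\<in>pverts (join K L). \<phi> (g v) = \<phi> v" using lab by (simp add: g_def)
    ultimately have "g v = v" using \<phi> v unfolding distinguishing_labeling_def by auto
    then show ?thesis using v by (simp add: g_def)
  qed
  then have "distinguishing_labeling (with_proj K)
      (distinguishing_number (with_proj (join K L))) \<phi>"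
    using \<phi> unfolding distinguishing_labeling_def by auto
  then show ?thesis by (rule distinguishing_number_le)
qed

text \<open>Between vertices of \<open>K\<close> the join has exactly the arcs of \<open>K\<close>.
  An automorphism that respects the sides can thus be tested against a labeling of one side
  alone.\<close>

lemma automorphism_restrict_left:
  assumes "automorphism (with_proj (join K L)) f" "f ` pverts K = pverts K"
  shows "automorphism (with_proj K) f"
proof -
  have "inj_on f (pverts K)"
    using assms(1) automorphism_with_proj_iff[OF wf_join] by (auto simp: bij_betw_def inj_on_Un)
  moreover have "(f u, f v) \<in> parcs K \<longleftrightarrow> (u, v) \<in> parcs K"
    if "u \<in> pverts K" "v \<in> pverts K" for u v
  proof -
    have "f u \<in> pverts K" "f v \<in> pverts K" using that assms(2) by auto
    then have "(f u, f v) \<in> parcs K \<longleftrightarrow> (f u, f v) \<in> parcs (join K L)"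
      using arc_join_left_iff by blast
    also have "\<dots> \<longleftrightarrow> (u, v) \<in> parcs (join K L)"
      using assms(1) that automorphism_with_proj_iff[OF wf_join] by auto
    finally show ?thesis using arc_join_left_iff that by blast
  qed
  ultimately show ?thesis
    using automorphism_with_proj_iff[OF K.pair_wf_digraph] assms(2) by (auto simp: bij_betw_def)
qed

end

section \<open>Isomorphism classes and numberings of their members\<close>

text \<open>Names the relation inside \<open>iso_classes\<close>, so that facts on equivalence
  relations and quotients apply to it.\<close>

definition iso_rel :: "('a, 'b) pre_digraph set \<Rightarrow> (('a, 'b) pre_digraph \<times> ('a, 'b) pre_digraph) set" where
  "iso_rel H = {(X, Y). X \<in> H \<and> Y \<in> H \<and> digraph_iso X Y}"

lemma iso_classes_quotient: "iso_classes H = H // iso_rel H"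
  by (simp add: iso_classes_def iso_rel_def)

lemma equiv_iso_rel:
  assumes "\<forall>X\<in>H. wf_digraph X"
  shows "equiv H (iso_rel H)"
proof (rule equivI)
  show "iso_rel H \<subseteq> H \<times> H" by (auto simp: iso_rel_def)
  show "refl_on H (iso_rel H)" using assms by (auto simp: iso_rel_def refl_on_def intro: digraph_iso_refl)
  show "sym (iso_rel H)" using assms by (auto simp: iso_rel_def sym_def intro: digraph_iso_swap)
  show "trans (iso_rel H)" by (auto simp: iso_rel_def trans_def intro: digraph_iso_trans)
qed

text \<open>Supplies the fresh labels: each class is numbered from 1 to its size, and numbers may
  repeat between different classes.\<close>

lemma ex_class_index:
  assumes "finite H" "equiv H R"
  shows "\<exists>\<kappa> :: _ \<Rightarrow> nat. (\<forall>x\<in>H. \<kappa> x \<in> {1..card (R `` {x})}) \<and>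
    (\<forall>x y. (x, y) \<in> R \<longrightarrow> \<kappa> x = \<kappa> y \<longrightarrow> x = y)"
proof -
  have fin: "finite (R `` {x})" for x
    using assms by (meson equiv_class_subset equiv_type finite_subset Image_subset)
  have "\<exists>g. bij_betw g C {1..card C}" if "finite C" for C :: "'a set"
    using ex_bij_betw_finite_nat[OF that] finite_same_card_bij[OF that, of "{1..card C}"] by simp
  then obtain g where g: "finite C \<Longrightarrow> bij_betw (g C) C {1..card C}" for C :: "'a set"
    by metis
  have bij: "bij_betw (g (R `` {x})) (R `` {x}) {1..card (R `` {x})}" for x
    by (rule g[OF fin])
  \<comment> \<open>The bijection is chosen once per class, so equivalent elements are numbered by
    the same one.\<close>
  define \<kappa> where "\<kappa> x = g (R `` {x}) x" for x
  have "\<kappa> x \<in> {1..card (R `` {x})}" if "x \<in> H" for x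
    using bij_betwE[OF bij] equiv_class_self[OF assms(2) that] unfolding \<kappa>_def by blast
  moreover have "x = y" if xy: "(x, y) \<in> R" and eq: "\<kappa> x = \<kappa> y" for x y
  proof -
    have "R `` {x} = R `` {y}" by (rule equiv_class_eq[OF assms(2) xy])
    moreover have "x \<in> R `` {x}" "y \<in> R `` {x}"
      using xy assms(2) by (auto dest: equivE refl_onD simp: equiv_class_self)
    ultimately show ?thesis
      using eq bij[of x] unfolding \<kappa>_def bij_betw_def by (auto dest: inj_onD)
  qed
  ultimately show ?thesis by blast
qed

lemma finite_induced_subgraphs: "finite (induced_subgraphs K As)"
  by (simp add: induced_subgraphs_def)

lemma (in wf_digraph) wf_induced_subgraphs: "\<forall>X\<in>induced_subgraphs G As. wf_digraph X"
  by (auto simp: induced_subgraphs_def)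

section \<open>Upper and lower bounds for the join\<close>

context disjoint_join
begin

text \<open>Only \<open>K\<close> receives marks, and \<open>z\<close> bounds only those of its
  classes that also occur on the \<open>L\<close> side. If there are none, \<open>z = 0\<close> is
  allowed, so one bound serves both claims of the theorem.\<close>

lemma distinguishing_number_join_le:
  fixes As Bs :: "'a set list" and z :: nat
  defines "H \<equiv> induced_subgraphs (with_proj (join K L)) As"
    and "H' \<equiv> induced_subgraphs (with_proj (join K L)) Bs"
  assumes As: "procedure_output (with_proj (join K L)) (pverts K) As"
    and Bs: "procedure_output (with_proj (join K L)) (pverts L) Bs"
    and card: "\<And>X Y. X \<in> H \<Longrightarrow> Y \<in> H' \<Longrightarrow> digraph_iso X Y \<Longrightarrow> card (iso_rel H `` {X}) \<le> z"
  shows "distinguishing_number (with_proj (join K L))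
    \<le> max (distinguishing_number (with_proj K)) (distinguishing_number (with_proj L)) + z"
proof -
  let ?G = "with_proj (join K L)"
  \<comment> \<open>Both optimal labelings are regarded as using \<open>{1..D}\<close>, which leaves
    the labels above \<open>D\<close> fresh.\<close>
  define D where "D = max (distinguishing_number (with_proj K)) (distinguishing_number (with_proj L))"
  interpret G: pair_wf_digraph "join K L" by (rule wf_join)
  have cK: "nonadjacency_closed ?G (pverts K)" by (rule closed_left)
  have cL: "nonadjacency_closed ?G (pverts L)"
    using disjoint_join.closed_left[OF swap] by (simp add: join_commute)
  note A = procedure_output_blocks[OF loopfree_join cK As]
  note B = procedure_output_blocks[OF loopfree_join cL Bs]
  obtain \<phi>K where "distinguishing_labeling (with_proj K) (distinguishing_number (with_proj K)) \<phi>K"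
    using ex_optimal_labeling[of "with_proj K"] K.pair_finite_verts by auto
  then have \<phi>K: "distinguishing_labeling (with_proj K) D \<phi>K"
    by (rule distinguishing_labeling_mono) (simp add: D_def)
  obtain \<phi>L where "distinguishing_labeling (with_proj L) (distinguishing_number (with_proj L)) \<phi>L"
    using ex_optimal_labeling[of "with_proj L"] L.pair_finite_verts by auto
  then have \<phi>L: "distinguishing_labeling (with_proj L) D \<phi>L"
    by (rule distinguishing_labeling_mono) (simp add: D_def)
  have equiv: "equiv H (iso_rel H)"
    unfolding H_def by (rule equiv_iso_rel[OF G.wf_induced_subgraphs])
  obtain \<kappa> :: "_ \<Rightarrow> nat" where \<kappa>_range: "\<And>X. X \<in> H \<Longrightarrow> \<kappa> X \<in> {1..card (iso_rel H `` {X})}"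
    and \<kappa>_inj: "\<And>X Y. (X, Y) \<in> iso_rel H \<Longrightarrow> \<kappa> X = \<kappa> Y \<Longrightarrow> X = Y"
    using ex_class_index[OF finite_induced_subgraphs equiv[unfolded H_def]] unfolding H_def by blast
  define matched where "matched = {C \<in> set As. \<exists>C'\<in>set Bs. digraph_iso (?G \<restriction> C) (?G \<restriction> C')}"
  have \<kappa>_le: "\<kappa> (?G \<restriction> C) \<in> {1..z}" if match: "C \<in> matched" for C
  proof -
    obtain C' where C: "C \<in> set As" "C' \<in> set Bs" "digraph_iso (?G \<restriction> C) (?G \<restriction> C')"
      using match unfolding matched_def by blast
    then have "?G \<restriction> C \<in> H" "?G \<restriction> C' \<in> H'" unfolding H_def H'_def induced_subgraphs_def by auto
    then show ?thesis using \<kappa>_range card C(3) by fastforce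
  qed
  have "\<forall>C\<in>set As. \<exists>x. x \<in> C" using A(1) unfolding block_def by blast
  then obtain mark where mark: "\<And>C. C \<in> set As \<Longrightarrow> mark C \<in> C" by metis
  have "\<forall>x\<in>pverts K. \<exists>C. C \<in> set As \<and> x \<in> C" using A(2) by blast
  from bchoice[OF this] obtain blk
    where blk: "\<And>x. x \<in> pverts K \<Longrightarrow> blk x \<in> set As \<and> x \<in> blk x" by blast
  have blk_eq: "blk x = C" if "C \<in> set As" "x \<in> C" for x C
  proof -
    have "x \<in> pverts K" using that A(1) by blast
    then show ?thesis using blk that A(1) block_eqI by metis
  qed
  define S where "S = mark ` matched"
  have S_sub: "S \<subseteq> pverts K" using mark A(1) unfolding S_def matched_def by blast
  \<comment> \<open>A mark loses its old label. As \<open>\<kappa>\<close> lies in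
    \<open>{1..z}\<close> on matched blocks, the new one lies strictly above \<open>D\<close> and at
    most at \<open>D + z\<close>.\<close>
  define \<phi> where "\<phi> x = (if x \<in> S then D + \<kappa> (?G \<restriction> blk x)
    else if x \<in> pverts K then \<phi>K x else \<phi>L x)" for x
  have S_blk: "blk x \<in> matched \<and> mark (blk x) = x" if "x \<in> S" for x
    using that mark blk_eq unfolding S_def matched_def by force
  have new: "\<phi> x > D" "\<phi> x \<le> D + z" if "x \<in> S" for x
    using that \<kappa>_le S_blk unfolding \<phi>_def by force+
  have old: "\<phi> x \<in> {1..D}" if "x \<in> pverts (join K L)" "x \<notin> S" for x
    using that \<phi>K \<phi>L unfolding \<phi>_def distinguishing_labeling_def by auto
  have fixed: "f v = v" if f: "automorphism ?G f"
    and lab: "\<forall>x\<in>pverts (join K L). \<phi> (f x) = \<phi> x" and v: "v \<in> pverts (join K L)" for f v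
  proof -
    note inj = automorphism_with_projD(1)[OF wf_join f]
      and im = automorphism_with_projD(2)[OF wf_join f]
    \<comment> \<open>Among the vertices of the join, labels above \<open>D\<close> occur exactly on
      \<open>S\<close>, so preserving labels preserves \<open>S\<close>.\<close>
    have fS: "f x \<in> S \<longleftrightarrow> x \<in> S" if "x \<in> pverts (join K L)" for x
    proof -
      have "f x \<in> pverts (join K L)" using that im by blast
      then show ?thesis using that lab old new by (metis atLeastAtMost_iff not_le)
    qed
    have block: "block ?G (f ` C)" if "C \<in> set As" for C
      using automorphism_block_image[OF wf_join f] that A(1) by blast
    have iso: "digraph_iso (?G \<restriction> C) (?G \<restriction> (f ` C))" if "C \<in> set As" for C
      using automorphism_induce_subgraph_iso[OF wf_join f] that A(1) by auto
    \<comment> \<open>If \<open>f\<close> moved \<open>x\<close> across, it would carry the whole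
      block of \<open>x\<close> onto a block of \<open>L\<close>. The block of \<open>x\<close>
      would then be matched, and its mark would be sent out of \<open>K\<close> although marks go to
      marks.\<close>
    have "f x \<in> pverts K" if x: "x \<in> pverts K" for x
    proof (rule ccontr)
      assume "f x \<notin> pverts K"
      moreover have "f x \<in> pverts (join K L)" using x im by auto
      ultimately have "f x \<in> pverts L" by simp
      then obtain C' where C': "C' \<in> set Bs" "f x \<in> C'" using B(2) by blast
      have C: "blk x \<in> set As" "x \<in> blk x" using blk[OF x] by auto
      have "f ` blk x = C'"
        using block_eqI[OF block[OF C(1)], of C' "f x"] C C' B(1) by blast
      then have "blk x \<in> matched" using iso[OF C(1)] C(1) C'(1) unfolding matched_def by auto
      then have "mark (blk x) \<in> S" unfolding S_def by blast
      then have "f (mark (blk x)) \<in> S" using fS S_sub by auto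
      moreover have "f (mark (blk x)) \<in> pverts L"
        using \<open>f ` blk x = C'\<close> mark[OF C(1)] C'(1) B(1) by blast
      ultimately show False using S_sub disjoint by blast
    qed
    then have sub: "f ` pverts K \<subseteq> pverts K" by blast
    have fK: "f ` pverts K = pverts K"
      using sub inj K.pair_finite_verts by (intro endo_inj_surj) (auto simp: inj_on_Un)
    have fL: "f ` pverts L = pverts L"
    proof -
      have "f ` pverts L = f ` (pverts (join K L) - pverts K)" using disjoint
        by (intro arg_cong[of _ _ "(`) f"]) auto
      also have "\<dots> = pverts (join K L) - pverts K"
        using inj_on_image_set_diff[OF inj, of "pverts (join K L)" "pverts K"] im fK by auto
      also have "\<dots> = pverts L" using disjoint by auto
      finally show ?thesis .
    qed
    \<comment> \<open>The blocks of \<open>x\<close> and \<open>f x\<close> are isomorphic and have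
      the same number under \<open>\<kappa>\<close>. They therefore coincide, and a block has only
      one mark.\<close>
    have S_fixed: "f x = x" if x: "x \<in> S" for x
    proof -
      have xK: "x \<in> pverts K" and fx: "f x \<in> S" using x S_sub fS by auto
      have C: "blk x \<in> set As" "x \<in> blk x" using blk[OF xK] by auto
      have fxK: "f x \<in> pverts K" using fx S_sub by blast
      have C': "blk (f x) \<in> set As" "f x \<in> blk (f x)" using blk[OF fxK] by auto
      have eq: "f ` blk x = blk (f x)"
        using block_eqI[OF block[OF C(1)], of "blk (f x)" "f x"] C C' A(1) by blast
      then have "(?G \<restriction> blk x, ?G \<restriction> blk (f x)) \<in> iso_rel H"
        using C(1) C'(1) iso[OF C(1)] unfolding iso_rel_def H_def induced_subgraphs_def by simp
      moreover have "\<kappa> (?G \<restriction> blk x) = \<kappa> (?G \<restriction> blk (f x))"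
      proof -
        have "\<phi> (f x) = \<phi> x" using lab xK by simp
        then show ?thesis using x fx unfolding \<phi>_def by simp
      qed
      ultimately have "?G \<restriction> blk x = ?G \<restriction> blk (f x)" by (rule \<kappa>_inj)
      then have "blk x = blk (f x)" by (metis induce_subgraph_verts)
      then show ?thesis using S_blk x fx by metis
    qed
    show ?thesis
    proof (cases "v \<in> pverts K")
      case True
      \<comment> \<open>Off the marks \<open>\<phi>\<close> still agrees with \<open>\<phi>K\<close>
        on \<open>K\<close>; at a mark the overwritten value is harmless because \<open>f\<close>
        fixes the mark.\<close>
      have "\<phi>K (f x) = \<phi>K x" if "x \<in> pverts K" for x
      proof (cases "x \<in> S")
        case False
        then have "f x \<notin> S" "f x \<in> pverts K" using that fS fK by auto
        moreover have "\<phi> (f x) = \<phi> x" using lab that by simp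
        ultimately show ?thesis using that False unfolding \<phi>_def by simp
      qed (simp add: S_fixed)
      then show ?thesis
        using \<phi>K True automorphism_restrict_left[OF f fK] unfolding distinguishing_labeling_def by auto
    next
      case False
      have "\<phi>L (f x) = \<phi>L x" if "x \<in> pverts L" for x
      proof -
        have "f x \<in> pverts L" using that fL by blast
        then have "x \<notin> pverts K" "f x \<notin> pverts K" "x \<notin> S" "f x \<notin> S"
          using that S_sub disjoint by auto
        moreover have "\<phi> (f x) = \<phi> x" using lab that by simp
        ultimately show ?thesis unfolding \<phi>_def by simp
      qed
      moreover have "automorphism (with_proj L) f"
        using disjoint_join.automorphism_restrict_left[OF swap] f fL by (simp add: join_commute)
      ultimately show ?thesis
        using \<phi>L False v unfolding distinguishing_labeling_def by auto
    qed
  qed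
  have "\<phi> ` pverts (join K L) \<subseteq> {1..D + z}"
  proof
    fix y assume "y \<in> \<phi> ` pverts (join K L)"
    then obtain x where x: "x \<in> pverts (join K L)" "y = \<phi> x" by blast
    show "y \<in> {1..D + z}" using old[OF x(1)] new[of x] x(2) by (cases "x \<in> S") auto
  qed
  then have "distinguishing_labeling ?G (D + z) \<phi>"
    using fixed unfolding distinguishing_labeling_def by (auto simp del: join_simps)
  then show ?thesis unfolding D_def by (rule distinguishing_number_le)
qed

lemma max_distinguishing_number_le_join:
  "max (distinguishing_number (with_proj K)) (distinguishing_number (with_proj L))
    \<le> distinguishing_number (with_proj (join K L))"
  using distinguishing_number_left_le disjoint_join.distinguishing_number_left_le[OF swap]
  by (simp add: join_commute)

end

section \<open>From the indexed isomorphism classes to the two claims\<close>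

theorem theorem2p5:
  fixes G1 G2 G :: "'a pair_pre_digraph"
    and As Bs :: "'a set list"
    and H H' :: "('a, 'a \<times> 'a) pre_digraph set"
    and \<A> \<B> :: "nat \<Rightarrow> ('a, 'a \<times> 'a) pre_digraph set"
    and n m :: "nat \<Rightarrow> nat"
    and t t' q :: nat
  assumes "pair_graph G1" and "pair_graph G2"
    and "pverts G1 \<inter> pverts G2 = {}"
    and "\<not> digraph_iso (with_proj G1) (with_proj G2)"
    and "G = join G1 G2"
    and "procedure_output (with_proj G) (pverts G1) As"
    and "procedure_output (with_proj G) (pverts G2) Bs"
    and "H = induced_subgraphs (with_proj G) As"
    and "H' = induced_subgraphs (with_proj G) Bs"
    and "bij_betw \<A> {1..t} (iso_classes H)"
    and "bij_betw \<B> {1..t'} (iso_classes H')"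
    and "\<And>i. i \<in> {1..t} \<Longrightarrow> n i = card (\<A> i)"
    and "\<And>j. j \<in> {1..t'} \<Longrightarrow> m j = card (\<B> j)"
    and "q = card {i \<in> {1..t}. \<exists>j\<in>{1..t'}. \<forall>X\<in>\<A> i. \<forall>Y\<in>\<B> j. digraph_iso X Y}"
    and "\<And>i X Y. i \<in> {1..q} \<Longrightarrow> X \<in> \<A> i \<Longrightarrow> Y \<in> \<B> i \<Longrightarrow> digraph_iso X Y"
    and "\<And>i j X Y. i \<in> {q<..t} \<Longrightarrow> j \<in> {1..t'} \<Longrightarrow> X \<in> \<A> i \<Longrightarrow> Y \<in> \<B> j
           \<Longrightarrow> \<not> digraph_iso X Y"
  shows "(q = 0 \<longrightarrow>
            distinguishing_number (with_proj G) =
              max (distinguishing_number (with_proj G1)) (distinguishing_number (with_proj G2)))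
       \<and> (\<forall>z. q \<noteq> 0 \<and> z = min (Max (n ` {1..q})) (Max (m ` {1..q})) \<longrightarrow>
            distinguishing_number (with_proj G) \<le>
              max (distinguishing_number (with_proj G1)) (distinguishing_number (with_proj G2)) + z)"
proof -
  interpret disjoint_join G1 G2 using assms(1-3) by (rule disjoint_join.intro)
  interpret J: pair_wf_digraph G using wf_join assms(5) by simp
  note H_eq = assms(8) and H'_eq = assms(9)
  have equivH: "equiv H (iso_rel H)" and equivH': "equiv H' (iso_rel H')"
    unfolding H_eq H'_eq by (rule equiv_iso_rel[OF J.wf_induced_subgraphs])+
  have wf: "wf_digraph X" if "X \<in> H \<union> H'" for X
    using that J.wf_induced_subgraphs unfolding H_eq H'_eq by blast
  have \<A>: "\<A> i \<in> H // iso_rel H" if "i \<in> {1..t}" for i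
    using assms(10) that iso_classes_quotient by (metis bij_betwE)
  have \<B>: "\<B> j \<in> H' // iso_rel H'" if "j \<in> {1..t'}" for j
    using assms(11) that iso_classes_quotient by (metis bij_betwE)
  have ex\<A>: "\<exists>i\<in>{1..t}. \<A> i = iso_rel H `` {X}" if "X \<in> H" for X
    using assms(10) quotientI[OF that] iso_classes_quotient by (metis bij_betw_imp_surj_on imageE)
  have ex\<B>: "\<exists>j\<in>{1..t'}. \<B> j = iso_rel H' `` {Y}" if "Y \<in> H'" for Y
    using assms(11) quotientI[OF that] iso_classes_quotient by (metis bij_betw_imp_surj_on imageE)
  \<comment> \<open>Isomorphic members of two indexed classes force the classes to be equal, and the
    indexing is injective.\<close>
  have uniq\<A>: "i = i'" if "i \<in> {1..t}" "i' \<in> {1..t}" "X \<in> \<A> i" "X' \<in> \<A> i'" "digraph_iso X X'" for i i' X X'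
  proof -
    have "X \<in> H" "X' \<in> H"
      using that in_quotient_imp_subset[OF equivH \<A>] by blast+
    then have "\<A> i = \<A> i'"
      using quotient_eqI[OF equivH \<A> \<A> that(3,4)] that by (simp add: iso_rel_def)
    then show ?thesis using assms(10) that(1,2) by (meson bij_betw_imp_inj_on inj_onD)
  qed
  have uniq\<B>: "j = j'" if "j \<in> {1..t'}" "j' \<in> {1..t'}" "Y \<in> \<B> j" "Y' \<in> \<B> j'" "digraph_iso Y Y'" for j j' Y Y'
  proof -
    have "Y \<in> H'" "Y' \<in> H'"
      using that in_quotient_imp_subset[OF equivH' \<B>] by blast+
    then have "\<B> j = \<B> j'"
      using quotient_eqI[OF equivH' \<B> \<B> that(3,4)] that by (simp add: iso_rel_def)
    then show ?thesis using assms(11) that(1,2) by (meson bij_betw_imp_inj_on inj_onD)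
  qed
  have ne\<A>: "\<exists>X. X \<in> \<A> i \<and> X \<in> H" if "i \<in> {1..t}" for i
    using in_quotient_imp_non_empty[OF equivH \<A>[OF that]]
      in_quotient_imp_subset[OF equivH \<A>[OF that]] by blast
  have ne\<B>: "\<exists>Y. Y \<in> \<B> j \<and> Y \<in> H'" if "j \<in> {1..t'}" for j
    using in_quotient_imp_non_empty[OF equivH' \<B>[OF that]]
      in_quotient_imp_subset[OF equivH' \<B>[OF that]] by blast
  \<comment> \<open>This makes \<open>\<B> i\<close> a genuine class for each \<open>i\<close> up to
    \<open>q\<close>. Choose for each matched left class an isomorphic right class: left classes
    with the same choice are isomorphic through it, hence equal.\<close>
  have "q \<le> t'"
  proof -
    define P where "P = {i \<in> {1..t}. \<exists>j\<in>{1..t'}. \<forall>X\<in>\<A> i. \<forall>Y\<in>\<B> j. digraph_iso X Y}"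
    then have "\<forall>i\<in>P. \<exists>j. j \<in> {1..t'} \<and> (\<forall>X\<in>\<A> i. \<forall>Y\<in>\<B> j. digraph_iso X Y)" by blast
    from bchoice[OF this] obtain h
      where h: "\<forall>i\<in>P. h i \<in> {1..t'} \<and> (\<forall>X\<in>\<A> i. \<forall>Y\<in>\<B> (h i). digraph_iso X Y)" by blast
    have "inj_on h P"
    proof (rule inj_onI)
      fix i i' assume i: "i \<in> P" "i' \<in> P" "h i = h i'"
      then have t: "i \<in> {1..t}" "i' \<in> {1..t}" by (auto simp: P_def)
      obtain X X' Y where "X \<in> \<A> i" "X' \<in> \<A> i'" "X' \<in> H" "Y \<in> \<B> (h i)"
        using ne\<A> ne\<B> t h i(1) by metis
      then show "i = i'"
        using uniq\<A>[OF t] h i wf digraph_iso_swap digraph_iso_trans by (metis UnI1)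
    qed
    moreover have "h ` P \<subseteq> {1..t'}" using h by blast
    ultimately have "card P \<le> card {1..t'}" by (intro card_inj_on_le) auto
    then show ?thesis using assms(14) P_def by simp
  qed
  \<comment> \<open>The index of \<open>X\<close> is at most \<open>q\<close>, since later classes
    have no partner. Any member of the right class with that index is isomorphic to
    \<open>X\<close>, hence to \<open>Y\<close>, so \<open>Y\<close> has the same index.\<close>
  have matched: "\<exists>i\<in>{1..q}. card (iso_rel H `` {X}) = n i \<and> card (iso_rel H' `` {Y}) = m i"
    if X: "X \<in> H" and Y: "Y \<in> H'" and iso: "digraph_iso X Y" for X Y
  proof -
    obtain i where i: "i \<in> {1..t}" "\<A> i = iso_rel H `` {X}" using ex\<A>[OF X] by blast
    obtain j where j: "j \<in> {1..t'}" "\<B> j = iso_rel H' `` {Y}" using ex\<B>[OF Y] by blast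
    have mem: "X \<in> \<A> i" "Y \<in> \<B> j"
      using i j equiv_class_self[OF equivH X] equiv_class_self[OF equivH' Y] by auto
    have iq: "i \<in> {1..q}" using assms(16)[OF _ j(1) mem] iso i(1) by (cases "i \<le> q") auto
    then have it: "i \<in> {1..t'}" using \<open>q \<le> t'\<close> by simp
    obtain Z where Z: "Z \<in> \<B> i" using ne\<B>[OF it] by blast
    have "digraph_iso Y Z"
      using assms(15)[OF iq mem(1) Z] iso wf X digraph_iso_swap digraph_iso_trans by (metis UnI1)
    then have "j = i" using uniq\<B>[OF j(1) it mem(2) Z] by blast
    then show ?thesis using iq i j assms(12,13) by metis
  qed
  have up: "distinguishing_number (with_proj G)
      \<le> max (distinguishing_number (with_proj G1)) (distinguishing_number (with_proj G2)) + z"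
    if "\<And>X Y. X \<in> H \<Longrightarrow> Y \<in> H' \<Longrightarrow> digraph_iso X Y \<Longrightarrow> card (iso_rel H `` {X}) \<le> z" for z
    using distinguishing_number_join_le[OF assms(6,7)[unfolded assms(5)]] that
    unfolding H_eq H'_eq assms(5) by blast
  \<comment> \<open>The same bound with the marks placed on \<open>G2\<close>, so that right-hand
    class sizes count.\<close>
  have up': "distinguishing_number (with_proj G)
      \<le> max (distinguishing_number (with_proj G1)) (distinguishing_number (with_proj G2)) + z"
    if le: "\<And>X Y. X \<in> H \<Longrightarrow> Y \<in> H' \<Longrightarrow> digraph_iso X Y \<Longrightarrow> card (iso_rel H' `` {Y}) \<le> z" for z
  proof -
    have G: "G = join G2 G1" using assms(5) join_commute by metis
    have "card (iso_rel H' `` {Y}) \<le> z" if "Y \<in> H'" "X \<in> H" "digraph_iso Y X" for X Y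
      using le that wf digraph_iso_swap by (metis UnI2)
    then show ?thesis
      using disjoint_join.distinguishing_number_join_le[OF swap assms(7,6)[unfolded G]]
      unfolding H_eq H'_eq G by (metis max.commute)
  qed
  show ?thesis
  proof (intro conjI impI allI)
    assume "q = 0"
    \<comment> \<open>Since \<open>{1..0}\<close> is empty, \<open>matched\<close> excludes any
      isomorphic pair, and no fresh label is spent.\<close>
    then have "distinguishing_number (with_proj G)
        \<le> max (distinguishing_number (with_proj G1)) (distinguishing_number (with_proj G2)) + 0"
      using matched by (intro up) fastforce
    then show "distinguishing_number (with_proj G) =
        max (distinguishing_number (with_proj G1)) (distinguishing_number (with_proj G2))"
      using max_distinguishing_number_le_join assms(5) by simp
  next
    fix z assume z: "q \<noteq> 0 \<and> z = min (Max (n ` {1..q})) (Max (m ` {1..q}))"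
    have "n i \<le> Max (n ` {1..q})" "m i \<le> Max (m ` {1..q})" if "i \<in> {1..q}" for i
      using that by auto
    \<comment> \<open>Marking the left side gives the bound with the \<open>n i\<close>, marking the
      right side the one with the \<open>m i\<close>; the smaller of the two maxima is
      \<open>z\<close>.\<close>
    then have "distinguishing_number (with_proj G)
        \<le> max (distinguishing_number (with_proj G1)) (distinguishing_number (with_proj G2)) + Max (n ` {1..q})"
      and "distinguishing_number (with_proj G)
        \<le> max (distinguishing_number (with_proj G1)) (distinguishing_number (with_proj G2)) + Max (m ` {1..q})"
      using matched by (intro up up'; metis)+
    then show "distinguishing_number (with_proj G)
        \<le> max (distinguishing_number (with_proj G1)) (distinguishing_number (with_proj G2)) + z"
      using z by (simp add: min_def)
  qed
qed

end
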